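(* Let $\mathcal{F}$ be a finite family of compact convex sets in $\mathbb{R}^d$. If the intersection of every $2d$ of them has increasing diameter at least one, then the increasing diameter of $\bigcap \mathcal{F}$ is at least $d^{-1/2}$.
   Context: For $x = (x_1, \ldots, x_d), y = (y_1, \ldots, y_d) \in \mathbb{R}^d$, write $x \ge y$ if $x_i \ge y_i$ for all $i$. The increasing diameter of a compact set $K \subset \mathbb{R}^d$ is $\max\{\|x - y\|_2 : x, y \in K, \ x \ge y\}$. *)

theory Defs
  imports "HOL-Analysis.Analysis"
begin

text \<open>
  The order on \<^typ>\<open>real ^ 'n\<close> is the componentwise one and its norm is the Euclidean norm.
  The maximum over an empty set is undefined; as for \<^const>\<open>diameter\<close>, the value for the
  empty set is 0, so that a positive lower bound on the increasing diameter
  entails nonemptiness.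
\<close>
definition increasing_diameter :: "(real ^ 'n) set \<Rightarrow> real" where
  "increasing_diameter K =
     (if K = {} then 0 else Sup {norm (x - y) |x y. x \<in> K \<and> y \<in> K \<and> x \<ge> y})"

text \<open>On nonempty compact sets the supremum is a maximum.\<close>
lemma increasing_diameter_is_max:
  fixes K :: "(real ^ 'n) set"
  assumes "compact K" and "K \<noteq> {}"
  shows "\<exists>x\<in>K. \<exists>y\<in>K. x \<ge> y \<and> increasing_diameter K = norm (x - y) \<and>
           (\<forall>u\<in>K. \<forall>v\<in>K. u \<ge> v \<longrightarrow> norm (u - v) \<le> norm (x - y))"
proof -
  let ?P = "(K \<times> K) \<inter> {p. snd p \<le> fst p}"
  have "closed {p :: (real ^ 'n) \<times> (real ^ 'n). snd p \<le> fst p}"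
    unfolding less_eq_vec_def
    by (intro closed_Collect_all closed_Collect_le continuous_intros)
  then have cP: "compact ?P"
    using assms(1) by (intro compact_Int_closed compact_Times)
  have neP: "?P \<noteq> {}"
    using assms(2) by auto
  have "continuous_on ?P (\<lambda>p. norm (fst p - snd p))"
    by (intro continuous_intros)
  from continuous_attains_sup[OF cP neP this]
  obtain p where p: "p \<in> ?P"
    and le_p: "\<And>q. q \<in> ?P \<Longrightarrow> norm (fst q - snd q) \<le> norm (fst p - snd p)"
    by blast
  define x y where "x = fst p" and "y = snd p"
  have xy: "x \<in> K" "y \<in> K" "y \<le> x"
    using p unfolding x_def y_def by auto
  have le: "norm (u - v) \<le> norm (x - y)" if "u \<in> K" "v \<in> K" "v \<le> u" for u v
    using le_p[of "(u, v)"] that unfolding x_def y_def by simp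
  have "Sup {norm (x - y) |x y. x \<in> K \<and> y \<in> K \<and> x \<ge> y} = norm (x - y)"
    by (rule cSup_eq_maximum) (use xy le in blast)+
  then have "increasing_diameter K = norm (x - y)"
    using assms(2) unfolding increasing_diameter_def by simp
  with xy le show ?thesis
    by (intro bexI[of _ x] bexI[of _ y]) auto
qed

end

theory Submission
  imports Defs
begin

text \<open>
  Replacing the Euclidean norm of \<open>x - y\<close> by \<open>\<Sum>i. x $ i - y $ i\<close> costs a factor of at most
  \<open>sqrt d\<close> and makes the condition linear. By convexity an increasing segment can be shortened
  until this sum is exactly 1, so the pairs \<open>(x, y)\<close> with \<open>x \<ge> y\<close> in a member of the
  family may be confined to a hyperplane of \<open>\<real>\<^sup>2\<^sup>d\<close>. There the Helly number is \<open>2d\<close>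
  rather than \<open>2d + 1\<close>.
\<close>

text \<open>Radon's proof of Helly's theorem, with the dimension of a set \<open>A\<close>
  containing all members in place of that of the ambient space. Asking for subfamilies of size at
  most \<open>n\<close>, not exactly \<open>n\<close>, lets the hypothesis pass to smaller index
  sets in the induction.\<close>

lemma Helly_aff_dim:
  fixes C :: "'i \<Rightarrow> 'a::euclidean_space set"
  assumes "finite I"
    and "\<And>i. i \<in> I \<Longrightarrow> convex (C i)"
    and "\<And>i. i \<in> I \<Longrightarrow> C i \<subseteq> A"
    and "aff_dim A < int n"
    and "0 < n"
    and "\<And>J. J \<subseteq> I \<Longrightarrow> card J \<le> n \<Longrightarrow> (\<Inter>i\<in>J. C i) \<noteq> {}"
  shows "(\<Inter>i\<in>I. C i) \<noteq> {}"
  using assms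
proof (induction I rule: finite_psubset_induct)
  case (psubset I)
  show ?case
  proof (cases "card I \<le> n")
    case True
    with psubset.prems(5) show ?thesis by blast
  next
    case False
    have "(\<Inter>j\<in>I - {i}. C j) \<noteq> {}" if "i \<in> I" for i
    proof (rule psubset.IH)
      show "I - {i} \<subset> I" using that by blast
      show "(\<Inter>j\<in>J. C j) \<noteq> {}" if "J \<subseteq> I - {i}" "card J \<le> n" for J
        using that psubset.prems(5) by blast
    qed (use psubset.prems in auto)
    then have "\<forall>i\<in>I. \<exists>x. x \<in> (\<Inter>j\<in>I - {i}. C j)"
      unfolding ex_in_conv by (rule ballI)
    from bchoice[OF this] obtain X where "\<forall>i\<in>I. X i \<in> (\<Inter>j\<in>I - {i}. C j)" ..
    then have X: "X i \<in> C j" if "i \<in> I" "j \<in> I" "i \<noteq> j" for i j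
      using that by simp
    show ?thesis
    proof (cases "inj_on X I")
      case False
      then obtain i k where "i \<in> I" "k \<in> I" "i \<noteq> k" "X i = X k"
        unfolding inj_on_def by blast
      then have "X i \<in> C j" if "j \<in> I" for j
        using X[of i j] X[of k j] that by (cases "i = j") auto
      then show ?thesis by blast
    next
      case True
      have XA: "X ` I \<subseteq> A"
      proof
        fix x assume "x \<in> X ` I"
        then obtain i where i: "i \<in> I" "x = X i" by blast
        \<comment> \<open>Membership in \<open>A\<close> comes from a second index, which exists
          because \<open>card I > n > 0\<close>.\<close>
        from \<open>\<not> card I \<le> n\<close> \<open>0 < n\<close> have "I \<noteq> {i}" by auto
        with i obtain j where "j \<in> I" "i \<noteq> j" by blast
        with X i psubset.prems(2) show "x \<in> A" by blast
      qed
      \<comment> \<open>An independent subset of \<open>A\<close> has at most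
        \<open>aff_dim A + 1\<close>, hence at most \<open>n\<close>, points.\<close>
      have "affine_dependent (X ` I)"
        using independent_card_le_aff_dim[OF XA] psubset.prems(3) \<open>\<not> card I \<le> n\<close>
        by (auto simp: card_image[OF True])
      with Radon_partition[of "X ` I"] psubset.hyps
      obtain M P where MP: "M \<inter> P = {}" "M \<union> P = X ` I"
        and "convex hull M \<inter> convex hull P \<noteq> {}" by auto
      then obtain z where z: "z \<in> convex hull M" "z \<in> convex hull P" by blast
      have "z \<in> C j" if j: "j \<in> I" for j
      proof -
        \<comment> \<open>Only \<open>X j\<close> can lie outside \<open>C j\<close>, and it belongs
          to just one of the two Radon parts; the other part lies in \<open>C j\<close>.\<close>
        have "M \<subseteq> C j \<or> P \<subseteq> C j"
        proof (cases "X j \<in> M")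
          case True
          have "P \<subseteq> C j"
          proof
            fix p assume "p \<in> P"
            with MP True obtain i where "i \<in> I" "p = X i" "i \<noteq> j" by blast
            with X j show "p \<in> C j" by blast
          qed
          then show ?thesis ..
        next
          case False
          have "M \<subseteq> C j"
          proof
            fix p assume "p \<in> M"
            with MP False obtain i where "i \<in> I" "p = X i" "i \<noteq> j" by blast
            with X j show "p \<in> C j" by blast
          qed
          then show ?thesis ..
        qed
        then have "convex hull M \<subseteq> C j \<or> convex hull P \<subseteq> C j"
          by (simp add: psubset.prems(1)[OF j] subset_hull)
        with z show ?thesis by blast
      qed
      then show ?thesis by blast
    qed
  qed
qed

text \<open>Cauchy-Schwarz against the all-ones vector, whose norm is the square root of the
  dimension.\<close>

lemma norm_ge_sum_div_sqrt_card:
  fixes v :: "real ^ 'n"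
  shows "(\<Sum>i\<in>UNIV. v $ i) / sqrt (real CARD('n)) \<le> norm v"
proof -
  have "norm (1 :: real ^ 'n) = sqrt (real CARD('n))"
    by (simp add: norm_vec_def L2_set_def)
  then have "(\<Sum>i\<in>UNIV. v $ i) \<le> norm v * sqrt (real CARD('n))"
    using norm_cauchy_schwarz[of v 1] by (simp add: inner_vec_def)
  then show ?thesis by (simp add: field_simps)
qed

lemma norm_le_increasing_diameter:
  fixes K :: "(real ^ 'n) set"
  assumes "compact K" "x \<in> K" "y \<in> K" "x \<ge> y"
  shows "norm (x - y) \<le> increasing_diameter K"
  using increasing_diameter_is_max[OF assms(1)] assms(2-) by fastforce

definition increasing_unit_pairs :: "(real ^ 'n) set \<Rightarrow> ((real ^ 'n) \<times> (real ^ 'n)) set" where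
  "increasing_unit_pairs K =
     {(x, y). x \<in> K \<and> y \<in> K \<and> x \<ge> y \<and> (\<Sum>i\<in>UNIV. x $ i - y $ i) = 1}"

lemma inner_one_diff:
  fixes x y :: "real ^ 'n"
  shows "1 \<bullet> x - 1 \<bullet> y = (\<Sum>i\<in>UNIV. x $ i - y $ i)"
  by (simp add: inner_vec_def sum_subtractf)

lemma convex_increasing_unit_pairs:
  fixes K :: "(real ^ 'n) set"
  assumes "convex K"
  shows "convex (increasing_unit_pairs K)"
proof -
  \<comment> \<open>Both the order and the normalisation are linear in the pair: one halfspace per
    coordinate, and one hyperplane.\<close>
  have "increasing_unit_pairs K =
      K \<times> K \<inter> (\<Inter>i. {p. (axis i (-1), axis i 1) \<bullet> p \<le> 0}) \<inter> {p. (1, -1) \<bullet> p = 1}"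
    by (auto simp: increasing_unit_pairs_def less_eq_vec_def inner_axis' inner_one_diff)
  then show ?thesis
    by (simp add: assms convex_Int convex_INT convex_Times convex_halfspace_le convex_hyperplane)
qed

lemma increasing_unit_pairs_nonempty:
  fixes K :: "(real ^ 'n) set"
  assumes "compact K" "convex K" "increasing_diameter K \<ge> 1"
  shows "increasing_unit_pairs K \<noteq> {}"
proof -
  have "K \<noteq> {}" using assms(3) by (auto simp: increasing_diameter_def)
  with increasing_diameter_is_max[OF assms(1)] assms(3)
  obtain x y where xy: "x \<in> K" "y \<in> K" "y \<le> x" "norm (x - y) \<ge> 1" by metis
  define s where "s = (\<Sum>i\<in>UNIV. x $ i - y $ i)"
  \<comment> \<open>As \<open>y \<le> x\<close>, \<open>s\<close> is the l1 norm of
    \<open>x - y\<close>, which dominates the Euclidean one.\<close>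
  have "norm (x - y) \<le> s"
    using norm_le_l1_cart[of "x - y"] xy(3) by (simp add: s_def less_eq_vec_def)
  with xy have s: "s \<ge> 1" by simp
  \<comment> \<open>Shrinking the segment towards \<open>y\<close> by the factor
    \<open>1 / s\<close> scales the sum to 1; \<open>s \<ge> 1\<close> keeps \<open>z\<close>
    between \<open>y\<close> and \<open>x\<close>.\<close>
  define z where "z = (1 - 1 / s) *\<^sub>R y + (1 / s) *\<^sub>R x"
  have "z \<in> K"
    unfolding z_def using s by (intro convexD[OF assms(2)] xy) auto
  moreover have zy: "z $ i - y $ i = (x $ i - y $ i) / s" for i
    using s by (simp add: z_def field_simps)
  then have "(\<Sum>i\<in>UNIV. z $ i - y $ i) = 1"
    using s by (simp add: s_def flip: sum_divide_distrib)
  moreover have "y $ i \<le> z $ i" for i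
    using zy[of i] xy(3) s by (smt (verit) divide_nonneg_nonneg less_eq_vec_def)
  then have "y \<le> z" by (simp add: less_eq_vec_def)
  ultimately show ?thesis
    using xy(2) by (auto simp: increasing_unit_pairs_def)
qed

theorem theorem3p9:
  fixes F :: "(real ^ 'n) set set"
  assumes "finite F" and "F \<noteq> {}"
    and "\<And>K. K \<in> F \<Longrightarrow> compact K \<and> convex K"
    and "\<And>G. G \<subseteq> F \<Longrightarrow> card G = min (2 * CARD('n)) (card F) \<Longrightarrow>
           increasing_diameter (\<Inter>G) \<ge> 1"
  shows "increasing_diameter (\<Inter>F) \<ge> real CARD('n) powr (-1/2)"
proof -
  let ?H = "{p :: (real ^ 'n) \<times> (real ^ 'n). (1, -1) \<bullet> p = 1}"
  have "(\<Inter>K\<in>F. increasing_unit_pairs K) \<noteq> {}"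
  proof (rule Helly_aff_dim)
    show "finite F" by fact
    show "convex (increasing_unit_pairs K)" if "K \<in> F" for K
      using assms(3) that convex_increasing_unit_pairs by blast
    show "increasing_unit_pairs K \<subseteq> ?H" for K :: "(real ^ 'n) set"
      by (auto simp: increasing_unit_pairs_def inner_one_diff)
    \<comment> \<open>A hyperplane of the product space has dimension
      \<open>2 * CARD('n) - 1\<close>.\<close>
    show "aff_dim ?H < int (2 * CARD('n))"
      by (subst aff_dim_hyperplane) (auto simp: zero_prod_def Suc_le_eq)
    show "0 < 2 * CARD('n)" by simp
    \<comment> \<open>The hypothesis speaks only of subfamilies of one fixed size, so
      \<open>J\<close> is enlarged to such a \<open>G\<close>; this only shrinks the
      intersection.\<close>
    fix J assume J: "J \<subseteq> F" "card J \<le> 2 * CARD('n)"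
    then obtain G where G: "J \<subseteq> G" "G \<subseteq> F" "card G = min (2 * CARD('n)) (card F)"
      using exists_subset_between[of J "min (2 * CARD('n)) (card F)" F] card_mono[of F J] assms(1)
      by auto
    \<comment> \<open>\<open>G\<close> must be nonempty: the empty intersection is the whole space,
      which is not compact.\<close>
    have "card F > 0" using assms(1,2) by (simp add: card_gt_0_iff)
    with G(3) have "G \<noteq> {}" by (auto simp: min_def split: if_splits)
    with G(2) assms(3) have "compact (\<Inter>G)" "convex (\<Inter>G)"
      by (auto intro!: compact_Inter convex_Inter)
    with G assms(4) have "increasing_unit_pairs (\<Inter>G) \<noteq> {}"
      by (intro increasing_unit_pairs_nonempty) auto
    moreover have "increasing_unit_pairs (\<Inter>G) \<subseteq> (\<Inter>K\<in>J. increasing_unit_pairs K)"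
      using G(1) by (auto simp: increasing_unit_pairs_def)
    ultimately show "(\<Inter>K\<in>J. increasing_unit_pairs K) \<noteq> {}" by (metis subset_empty)
  qed
  then obtain x y where "(x, y) \<in> (\<Inter>K\<in>F. increasing_unit_pairs K)"
    by (metis ex_in_conv surj_pair)
  then have xy: "x \<in> \<Inter>F" "y \<in> \<Inter>F" "y \<le> x" "(\<Sum>i\<in>UNIV. x $ i - y $ i) = 1"
    using assms(2) by (auto simp: increasing_unit_pairs_def)
  have "real CARD('n) powr (-1/2) = 1 / sqrt (real CARD('n))"
    by (simp add: powr_minus_divide powr_half_sqrt)
  also have "\<dots> \<le> norm (x - y)"
    using norm_ge_sum_div_sqrt_card[of "x - y"] xy(4) by simp
  also have "\<dots> \<le> increasing_diameter (\<Inter>F)"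
    using assms(2,3) xy by (intro norm_le_increasing_diameter compact_Inter) auto
  finally show ?thesis .
qed

end
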